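(* Let $\theta_1$ and $\theta_2$ be inner functions and let $\phi$ be a holomorphic self map of the open unit disk $\mathbb{D}$. Then $C_{\phi}(\theta_1H^p)\subseteq\theta_2H^p$ for some $p>0$ if and only if $(\theta_1\circ\phi)/\theta_2\in H^{\infty}$.
   Context: For $0<p<\infty$, $H^p$ is the Hardy space of holomorphic functions $f$ on the open unit disk $\mathbb{D}$ with $\sup_{0\le r<1}\frac{1}{2\pi}\int_0^{2\pi}|f(re^{it})|^p\,dt<\infty$; $H^\infty$ is the algebra of bounded holomorphic functions on $\mathbb{D}$. An inner function is a $\theta\in H^\infty$ whose radial limits have modulus $1$ almost everywhere on the unit circle. $\theta H^p=\{\theta f: f\in H^p\}$. For a holomorphic self map $\phi$ of $\mathbb{D}$, $C_\phi(f)=f\circ\phi$ is the composition operator; it maps $H^p$ into itself. "$(\theta_1\circ\phi)/\theta_2\in H^\infty$" means that there is $f\in H^\infty$ with $\theta_1\circ\phi=\theta_2 f$ on $\mathbb{D}$. *)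

theory Defs
  imports "HOL-Complex_Analysis.Complex_Analysis"
begin

text \<open>
  A function on the open unit disk is represented by a total function on the complex
  plane whose values off the disk are irrelevant: every set of functions below is closed under
  changing values outside \<open>ball 0 1\<close>.
\<close>

definition hardy :: "real \<Rightarrow> (complex \<Rightarrow> complex) set" where
  "hardy p = {f. f holomorphic_on ball 0 1 \<and>
     bdd_above ((\<lambda>r. 1 / (2 * pi) *
       integral {0..2*pi} (\<lambda>t. norm (f (of_real r * cis t)) powr p)) ` {0..<1::real})}"

definition hardy_inf :: "(complex \<Rightarrow> complex) set" where
  "hardy_inf = {f. f holomorphic_on ball 0 1 \<and> bounded (f ` ball 0 1)}"

text \<open>
  The existence of the radial limit almost everywhere is part of the condition; for bounded
  holomorphic functions it is automatic by Fatou's theorem.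
\<close>

definition inner_function :: "(complex \<Rightarrow> complex) \<Rightarrow> bool" where
  "inner_function \<theta> \<longleftrightarrow> \<theta> \<in> hardy_inf \<and>
     (AE t in lebesgue_on {0..2*pi}.
        \<exists>L. ((\<lambda>r. \<theta> (of_real r * cis t)) \<longlongrightarrow> L) (at_left (1::real)) \<and> norm L = 1)"

definition mult_space ::
    "(complex \<Rightarrow> complex) \<Rightarrow> (complex \<Rightarrow> complex) set \<Rightarrow> (complex \<Rightarrow> complex) set" where
  "mult_space \<theta> X = {g. \<exists>f\<in>X. \<forall>z\<in>ball 0 1. g z = \<theta> z * f z}"

definition disk_self_map :: "(complex \<Rightarrow> complex) \<Rightarrow> bool" where
  "disk_self_map \<phi> \<longleftrightarrow> \<phi> holomorphic_on ball 0 1 \<and> \<phi> ` ball 0 1 \<subseteq> ball 0 1"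

definition composition_op ::
    "(complex \<Rightarrow> complex) \<Rightarrow> (complex \<Rightarrow> complex) \<Rightarrow> (complex \<Rightarrow> complex)" where
  "composition_op \<phi> f = f \<circ> \<phi>"

end

theory Submission
  imports Defs
begin

text \<open>
  Both directions rest on one inequality: if \<open>f\<close> lies in the disk algebra and \<open>q > 0\<close>, then
  \<open>|f|\<^sup>q\<close> is dominated inside the disk by the Poisson integral of its boundary values
  (\<open>norm_powr_le_poisson_integral\<close>). Applied to the dilates \<open>f (r z)\<close>, it gives estimates
  for arbitrary holomorphic functions.

  Suppose that the inclusion holds for some \<open>p\<close>. As the constant \<open>1\<close> belongs to \<open>H\<^sup>p\<close>, it
  yields \<open>\<theta>\<^sub>1 \<circ> \<phi> = \<theta>\<^sub>2 f\<close> with \<open>f \<in> H\<^sup>p\<close>. The left side is bounded, say by \<open>C\<close>, and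
  \<open>|\<theta>\<^sub>2|\<close> tends radially to \<open>1\<close> almost everywhere, so that formally \<open>|f| \<le> C\<close> on the
  circle. That this carries over to the disk (\<open>hardy_quotient_by_inner_bounded\<close>) is where
  membership in \<open>H\<^sup>p\<close> enters: with \<open>q = p / 2\<close> the functions \<open>|f (r e\<^sup>i\<^sup>t)|\<^sup>q\<close> are bounded
  in \<open>L\<^sup>2\<close>, hence their Poisson integrals put little mass on the set where \<open>|\<theta>\<^sub>2|\<close> is not yet
  close to \<open>1\<close>. Without it the claim fails: \<open>f\<close> could be the reciprocal of a singular
  inner function.

  Conversely, let \<open>\<theta>\<^sub>1 \<circ> \<phi> = \<theta>\<^sub>2 f\<close> with \<open>f\<close> bounded. Then
  \<open>(\<theta>\<^sub>1 g) \<circ> \<phi> = \<theta>\<^sub>2 (f (g \<circ> \<phi>))\<close>, and it remains to know that composition with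
  \<open>\<phi>\<close> preserves \<open>H\<^sup>p\<close>. This is Littlewood's subordination principle
  (\<open>littlewood_subordination\<close>): integrate the above inequality at the points \<open>\<phi> (r e\<^sup>i\<^sup>t)\<close>
  over \<open>t\<close>, exchange the integrals, and use that the Poisson kernel is harmonic in its first
  argument.
\<close>

section \<open>The Poisson kernel\<close>

definition poisson :: "complex \<Rightarrow> real \<Rightarrow> real" where
  "poisson z t = (1 - (norm z)\<^sup>2) / (norm (cis t - z))\<^sup>2"

lemma cis_neq_in_disk: "norm z < 1 \<Longrightarrow> cis t \<noteq> z"
  by auto

lemma poisson_nonneg: "norm z < 1 \<Longrightarrow> 0 \<le> poisson z t"
  by (auto simp: poisson_def power_le_one)

lemma poisson_le:
  assumes "norm z < 1"
  shows "poisson z t \<le> 2 / (1 - norm z)"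
proof -
  have d: "1 - norm z \<le> norm (cis t - z)"
    using norm_triangle_ineq2[of "cis t" z] by simp
  have "poisson z t \<le> (1 - (norm z)\<^sup>2) / (1 - norm z)\<^sup>2"
    unfolding poisson_def using assms d
    by (intro divide_left_mono mult_pos_pos power_mono) (auto simp: power_le_one cis_neq_in_disk)
  also have "\<dots> = (1 + norm z) / (1 - norm z)"
    using assms by (simp add: divide_simps) (simp add: power2_eq_square algebra_simps)
  also have "\<dots> \<le> 2 / (1 - norm z)"
    using assms by (intro divide_right_mono) auto
  finally show ?thesis .
qed

lemma poisson_eq_Re:
  assumes "norm z < 1"
  shows "poisson z t = Re ((cis t + z) / (cis t - z))"
proof -
  have "(cis t + z) * cnj (cis t - z) = of_real (1 - (norm z)\<^sup>2) + (z * cnj (cis t) - cnj (z * cnj (cis t)))"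
    by (simp add: algebra_simps complex_norm_square[symmetric] flip: complex_norm_square)
  hence "Re ((cis t + z) * cnj (cis t - z)) = 1 - (norm z)\<^sup>2"
    by (simp only: plus_complex.sel minus_complex.sel Re_complex_of_real cnj.sel)
  thus ?thesis
    unfolding poisson_def by (subst complex_div_cnj) (metis Re_divide_of_real of_real_power)
qed

lemma continuous_on_poisson:
  assumes "norm z < 1"
  shows "continuous_on A (poisson z)"
  unfolding poisson_def using assms by (intro continuous_intros) (auto simp: cis_neq_in_disk)

text \<open>
  This is Cauchy's formula at \<open>z\<close> for \<open>F w (1 - |z|\<^sup>2) / (1 - cnj z w)\<close>: the extra factor is
  holomorphic on the closed disk, equals \<open>1\<close> at \<open>w = z\<close>, and turns the Cauchy kernel into the
  Poisson kernel where \<open>|w| = 1\<close>.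
\<close>
lemma poisson_formula:
  assumes "continuous_on (cball 0 1) F" "F holomorphic_on ball 0 1" "norm z < 1"
  shows "((\<lambda>t. of_real (poisson z t) * F (cis t)) has_integral 2 * of_real pi * F z) {0..2*pi}"
proof -
  have nz: "1 - cnj z * w \<noteq> 0" if "norm w \<le> 1" for w
  proof
    assume "1 - cnj z * w = 0"
    hence "norm (cnj z * w) = 1" by (metis eq_iff_diff_eq_0 norm_one)
    moreover have "norm z * norm w \<le> norm z * 1" using that by (intro mult_left_mono) auto
    ultimately show False using assms(3) by (simp add: norm_mult)
  qed
  define c where "c = complex_of_real (1 - (norm z)\<^sup>2)"
  have c: "1 - cnj z * z = c"
    unfolding c_def by (metis complex_norm_square mult.commute of_real_1 of_real_diff)
  define G where "G = (\<lambda>w. F w * c / (1 - cnj z * w))"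
  have "continuous_on (cball 0 1) G"
    unfolding G_def by (intro continuous_intros assms) (use nz in auto)
  moreover have "G holomorphic_on ball 0 1"
    unfolding G_def by (intro holomorphic_intros assms) (use nz in auto)
  ultimately have "((\<lambda>u. G u / (u - z)) has_contour_integral (2 * of_real pi * \<i> * G z)) (circlepath 0 1)"
    using assms by (intro Cauchy_integral_circlepath) auto
  hence I: "((\<lambda>t. G (cis t) / (cis t - z) * \<i> * cis t) has_integral (2 * of_real pi * \<i> * G z)) {0..2*pi}"
    unfolding circlepath_def by (subst (asm) has_contour_integral_part_circlepath_iff) auto
  have G: "G z = F z"
    using nz[of z] assms(3) by (simp add: G_def flip: c)
  have k: "G (cis t) / (cis t - z) * \<i> * cis t = \<i> * (of_real (poisson z t) * F (cis t))" for t
  proof -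
    have e: "cis t * cnj (cis t) = 1"
      by (simp flip: complex_norm_square)
    have "1 - cnj z * cis t = cis t * cnj (cis t - z)"
      using e by (simp add: algebra_simps)
    moreover have "of_real (poisson z t) = c / ((cis t - z) * cnj (cis t - z))"
      unfolding poisson_def c_def complex_norm_square[symmetric] by (rule of_real_divide)
    ultimately show ?thesis
      by (simp add: G_def mult_ac)
  qed
  show ?thesis
    using has_integral_mult_right[OF I[unfolded k G], of "-\<i>"] by (simp add: algebra_simps)
qed

section \<open>Approximation on the circle by real parts of polynomials\<close>

text \<open>
  On the unit circle \<open>z * cnj z = 1\<close>, so that a product \<open>z\<^sup>m * cnj z\<^sup>n\<close> is a power of \<open>z\<close> or of
  \<open>cnj z\<close>, and both have the same real part up to conjugating coefficients. The induction
  strips one factor \<open>z\<close> from each polynomial at a time.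
\<close>
lemma Re_poly_mult_cnj_on_circle:
  "\<exists>r. \<forall>z. norm z = 1 \<longrightarrow> Re (poly p z * cnj (poly q z)) = Re (poly r z)"
proof (induction p arbitrary: q)
  case 0
  show ?case by (intro exI[of _ 0]) auto
next
  case (pCons a p)
  obtain b q' where q: "q = pCons b q'" by (cases q)
  obtain r where r: "\<And>z. norm z = 1 \<Longrightarrow> Re (poly p z * cnj (poly q' z)) = Re (poly r z)"
    using pCons.IH by blast
  show ?case
  proof (intro exI allI impI)
    fix z :: complex assume z: "norm z = 1"
    have e: "z * cnj z = 1"
      using z by (simp flip: complex_norm_square)
    have "(a + z * poly p z) * cnj (b + z * poly q' z) =
       a * cnj b + cnj b * (z * poly p z) + cnj (cnj a * (z * poly q' z)) + (z * cnj z) * (poly p z * cnj (poly q' z))"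
      by (simp add: algebra_simps)
    hence "Re (poly (pCons a p) z * cnj (poly q z)) = Re (a * cnj b) + Re (cnj b * (z * poly p z))
       + Re (cnj a * (z * poly q' z)) + Re (poly r z)"
      unfolding e q using r[OF z] by (simp only: poly_pCons plus_complex.sel mult_1_left cnj.sel)
    thus "Re (poly (pCons a p) z * cnj (poly q z)) =
       Re (poly ([:a * cnj b:] + smult (cnj b) (pCons 0 p) + smult (cnj a) (pCons 0 q') + r) z)"
      by (simp add: algebra_simps)
  qed
qed

text \<open>
  The restrictions to the circle of real parts of polynomials form an algebra, since
  \<open>2 * Re a * Re b = Re (a * b) + Re (a * cnj b)\<close>. They are the explicit harmonic functions
  with which the Dirichlet problem is solved approximately below.
\<close>
lemma real_polynomial_on_circle:
  assumes "real_polynomial_function (g :: complex \<Rightarrow> real)"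
  shows "\<exists>p. \<forall>z. norm z = 1 \<longrightarrow> g z = Re (poly p z)"
  using assms
proof induction
  case (linear f)
  interpret bounded_linear f by fact
  have "f z = Re (poly [:0, Complex (f 1) (- f \<i>):] z)" for z
  proof -
    have "z = Re z *\<^sub>R 1 + Im z *\<^sub>R \<i>" by (simp add: complex_eq_iff)
    hence "f z = Re z * f 1 + Im z * f \<i>" by (metis add scaleR real_scaleR_def)
    thus ?thesis by simp
  qed
  thus ?case by blast
next
  case (const c)
  show ?case by (intro exI[of _ "[:of_real c:]"]) auto
next
  case (add f g)
  then obtain p q where "\<forall>z. norm z = 1 \<longrightarrow> f z = Re (poly p z)" "\<forall>z. norm z = 1 \<longrightarrow> g z = Re (poly q z)"
    by blast
  thus ?case by (intro exI[of _ "p + q"]) auto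
next
  case (mult f g)
  then obtain p q where pq: "\<forall>z. norm z = 1 \<longrightarrow> f z = Re (poly p z)" "\<forall>z. norm z = 1 \<longrightarrow> g z = Re (poly q z)"
    by blast
  obtain r where r: "\<forall>z. norm z = 1 \<longrightarrow> Re (poly p z * cnj (poly q z)) = Re (poly r z)"
    using Re_poly_mult_cnj_on_circle by blast
  have "2 * (f z * g z) = Re (poly (p * q + r) z)" if "norm z = 1" for z
  proof -
    have "2 * (Re a * Re b) = Re (a * b) + Re (a * cnj b)" for a b :: complex by simp
    thus ?thesis using pq r that by (metis plus_complex.sel(1) poly_add poly_mult)
  qed
  hence "f z * g z = Re (poly (smult (1/2) (p * q + r)) z)" if "norm z = 1" for z
    using that by (auto simp: field_simps)
  thus ?case by blast
qed

lemma Re_poly_dense_on_circle: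
  fixes u :: "complex \<Rightarrow> real"
  assumes "continuous_on (sphere 0 1) u" "0 < e"
  obtains p where "\<And>z. norm z = 1 \<Longrightarrow> \<bar>u z - Re (poly p z)\<bar> < e"
proof -
  obtain g where "real_polynomial_function g" "\<And>z. z \<in> sphere 0 1 \<Longrightarrow> \<bar>u z - g z\<bar> < e"
    using Stone_Weierstrass_real_polynomial_function[OF compact_sphere assms] by metis
  with real_polynomial_on_circle[of g] that show ?thesis by (metis mem_sphere_0)
qed

section \<open>Subharmonicity of powers of the modulus\<close>

text \<open>
  Near a point where \<open>f\<close> does not vanish, \<open>|f|\<^sup>q\<close> is the modulus of a holomorphic branch of the
  power, and after a rotation its real part agrees with the modulus at that point. So an
  interior positive maximum of \<open>|f|\<^sup>q - Re P\<close> is a maximum of a harmonic function and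
  propagates to a neighbourhood. Choosing the maximum point of largest norm makes this
  absurd. At a zero of \<open>f\<close> there cannot be a positive maximum because \<open>Re P \<ge> 0\<close>.
\<close>
lemma maximum_principle_powr:
  fixes f P :: "complex \<Rightarrow> complex"
  assumes f: "continuous_on (cball 0 1) f" "f holomorphic_on ball 0 1"
    and P: "continuous_on (cball 0 1) P" "P holomorphic_on ball 0 1"
    and q: "0 < q"
    and le: "\<And>w. norm w = 1 \<Longrightarrow> norm (f w) powr q \<le> Re (P w)"
    and z: "norm z < 1"
  shows "norm (f z) powr q \<le> Re (P z)"
proof (rule ccontr)
  assume neg: "\<not> ?thesis"
  define v where "v = (\<lambda>w. norm (f w) powr q - Re (P w))"
  have cv: "continuous_on (cball 0 1) v"
    unfolding v_def using q by (intro continuous_intros continuous_on_powr' f P) auto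
  obtain z1 where z1: "z1 \<in> cball 0 1" "\<And>w. w \<in> cball 0 1 \<Longrightarrow> v w \<le> v z1"
    using continuous_attains_sup[OF compact_cball _ cv] by (metis cball_eq_empty not_one_less_zero)
  have vpos: "v z1 > 0" using z1(2)[of z] neg z by (simp add: v_def)
  \<comment> \<open>A maximum point \<open>z0\<close> of largest norm is contradicted at the end by a nearby one of larger norm.\<close>
  define S where "S = {w \<in> cball 0 1. v w = v z1}"
  have "closed S" unfolding S_def
    using continuous_closed_preimage_constant[OF cv closed_cball] by simp
  hence "compact S" by (metis S_def bounded_cball bounded_subset compact_eq_bounded_closed mem_Collect_eq subsetI)
  moreover have "z1 \<in> S" using z1 by (simp add: S_def)
  moreover have "continuous_on S norm" by (intro continuous_intros)
  ultimately obtain z0 where z0: "z0 \<in> S" "\<And>w. w \<in> S \<Longrightarrow> norm w \<le> norm z0"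
    using continuous_attains_sup[of S norm] by blast
  have v0: "v z0 = v z1" and z0c: "norm z0 \<le> 1" using z0(1) by (auto simp: S_def)
  have z0b: "norm z0 < 1"
    using le[of z0] vpos v0 z0c by (cases "norm z0 = 1") (auto simp: v_def)
  have Pnn: "0 \<le> Re (P z0)"
  proof -
    have "Re (- P z0) \<le> 0"
    proof (rule maximum_real_frontier[of "\<lambda>w. - P w" "cball 0 1"])
      show "(\<lambda>w. - P w) holomorphic_on interior (cball 0 1)" using P by (auto intro: holomorphic_intros)
      show "continuous_on (closure (cball 0 1)) (\<lambda>w. - P w)" using P by (auto intro: continuous_intros)
      show "Re (- P w) \<le> 0" if "w \<in> frontier (cball 0 1)" for w
        using order_trans[OF powr_ge_zero le, of w] that by auto
    qed (use z0c in auto)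
    thus ?thesis by simp
  qed
  have fz0: "f z0 \<noteq> 0"
    using vpos v0 Pnn q by (auto simp: v_def)
  obtain d1 where d1: "d1 > 0" "ball z0 d1 \<subseteq> ball 0 1"
    using z0b by (metis open_ball openE mem_ball_0)
  have "continuous (at z0) f"
    using f z0b by (meson continuous_on_interior holomorphic_on_imp_continuous_on open_ball mem_ball_0 continuous_on_eq_continuous_at)
  then obtain d2 where d2: "d2 > 0" "\<And>w. dist z0 w < d2 \<Longrightarrow> f w \<noteq> 0"
    using continuous_at_avoid[of z0 f 0] fz0 by blast
  define B where "B = ball z0 (min d1 d2)"
  have B: "B \<subseteq> ball 0 1" "z0 \<in> B" "open B" "connected B" "convex B" "\<And>w. w \<in> B \<Longrightarrow> f w \<noteq> 0"
    using d1 d2 by (auto simp: B_def)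
  obtain g where g: "g holomorphic_on B" "\<And>w. w \<in> B \<Longrightarrow> f w = exp (g w)"
    using contractible_imp_holomorphic_log[of f B] holomorphic_on_subset[OF f(2) B(1)] B
      convex_imp_contractible by metis
  \<comment> \<open>The rotation makes \<open>c * exp (q * g)\<close>, a branch of the power of \<open>f\<close>, positive at \<open>z0\<close>.\<close>
  define c where "c = cis (- q * Im (g z0))"
  define h where "h = (\<lambda>w. c * exp (of_real q * g w) - P w)"
  have nf: "norm (exp (of_real q * g w)) = norm (f w) powr q" if "w \<in> B" for w
    using g(2)[OF that] by (simp add: powr_def)
  have hv: "Re (h w) \<le> v w" if "w \<in> B" for w
  proof -
    have "Re (c * exp (of_real q * g w)) \<le> norm (c * exp (of_real q * g w))" by (rule complex_Re_le_cmod)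
    also have "\<dots> = norm (f w) powr q" using nf[OF that] by (simp add: norm_mult c_def)
    finally show ?thesis by (simp add: h_def v_def)
  qed
  have h0: "Re (h z0) = v z0"
  proof -
    have "c * exp (of_real q * g z0) = of_real (exp (q * Re (g z0)))"
      by (simp add: c_def exp_eq_polar cis_mult mult.left_commute)
    thus ?thesis using g(2)[OF B(2)] by (simp add: h_def v_def powr_def)
  qed
  have "(\<lambda>w. exp (h w)) constant_on B"
  proof (rule maximum_modulus_principle[of _ B B z0])
    show "(\<lambda>w. exp (h w)) holomorphic_on B"
      unfolding h_def using g holomorphic_on_subset[OF P(2) B(1)] by (intro holomorphic_intros)
    show "norm (exp (h w)) \<le> norm (exp (h z0))" if "w \<in> B" for w
      using hv[OF that] h0 v0 z1(2)[of w] B(1) that by auto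
  qed (use B in auto)
  hence "Re (h w) = Re (h z0)" if "w \<in> B" for w
    using that B(2) unfolding constant_on_def by (metis exp_inj_iff norm_exp_eq_Re)
  hence ge: "v z1 \<le> v w" if "w \<in> B" for w
    using hv[OF that] h0 v0 that by metis
  have BS: "w \<in> S" if "w \<in> B" for w
  proof -
    have "w \<in> cball 0 1" using B(1) that by auto
    thus ?thesis using ge[OF that] z1(2)[of w] by (simp add: S_def)
  qed
  \<comment> \<open>Stepping outwards from \<open>z0\<close> stays among the maximum points but increases the norm.\<close>
  define s where "s = min d1 d2 / 2"
  have s: "s > 0" "s < min d1 d2" using d1 d2 by (auto simp: s_def)
  define w where "w = (if z0 = 0 then of_real s else z0 + of_real s * sgn z0)"
  have "dist z0 w = s" using s by (simp add: w_def dist_norm norm_mult norm_sgn)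
  hence "w \<in> B" using s by (simp add: B_def)
  moreover have "norm w > norm z0"
  proof (cases "z0 = 0")
    case True
    thus ?thesis using s by (simp add: w_def)
  next
    case False
    have "z0 = of_real (norm z0) * sgn z0"
      using False by (simp add: sgn_eq)
    hence "w = of_real (norm z0 + s) * sgn z0"
      using False unfolding w_def by (metis distrib_right of_real_add)
    hence "norm w = \<bar>norm z0 + s\<bar>"
      using False by (simp add: norm_mult norm_sgn del: of_real_add)
    thus ?thesis using s by simp
  qed
  ultimately show False using z0(2)[OF BS] by (meson not_le)
qed

lemma poisson_has_integral_1:
  assumes "norm z < 1"
  shows "(poisson z has_integral 2 * pi) {0..2*pi}"
  using has_integral_Re[OF poisson_formula[of "\<lambda>_. 1" z]] assms by simp

text \<open>
  Approximate the boundary values of \<open>|f|\<^sup>q\<close> from above by \<open>Re P\<close> for a polynomial \<open>P\<close>. The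
  maximum principle gives \<open>|f|\<^sup>q \<le> Re P\<close> inside, and \<open>Re P\<close> is its own Poisson integral.
\<close>
lemma norm_powr_le_poisson_integral:
  fixes f :: "complex \<Rightarrow> complex"
  assumes f: "continuous_on (cball 0 1) f" "f holomorphic_on ball 0 1"
    and q: "0 < q" and z: "norm z < 1"
  shows "2 * pi * norm (f z) powr q
          \<le> integral {0..2*pi} (\<lambda>t. poisson z t * norm (f (cis t)) powr q)"
proof (rule field_le_epsilon)
  fix e :: real assume e: "0 < e"
  define d where "d = e / (4 * pi)"
  have d: "d > 0" using e by (simp add: d_def)
  have cu: "continuous_on (cball 0 1) (\<lambda>w. norm (f w) powr q)"
    using q by (intro continuous_intros continuous_on_powr' f) auto
  hence "continuous_on (sphere 0 1) (\<lambda>w. norm (f w) powr q)"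
    by (rule continuous_on_subset) auto
  then obtain p where p: "\<And>w. norm w = 1 \<Longrightarrow> \<bar>norm (f w) powr q - Re (poly p w)\<bar> < d"
    using Re_poly_dense_on_circle d by metis
  define P where "P = (\<lambda>w. poly p w + of_real d)"
  have P: "continuous_on (cball 0 1) P" "P holomorphic_on ball 0 1"
    unfolding P_def by (auto intro!: continuous_intros holomorphic_intros)
  have u: "norm (f w) powr q \<le> Re (P w)" "Re (P w) \<le> norm (f w) powr q + 2 * d"
    if "norm w = 1" for w
    using p[OF that] by (auto simp: P_def)
  have "((\<lambda>t. poisson z t * Re (P (cis t))) has_integral 2 * pi * Re (P z)) {0..2*pi}"
    using has_integral_Re[OF poisson_formula[OF P z]] by (simp del: of_real_mult)
  moreover have "((\<lambda>t. poisson z t * norm (f (cis t)) powr q + poisson z t * (2 * d)) has_integral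
       integral {0..2*pi} (\<lambda>t. poisson z t * norm (f (cis t)) powr q) + 2 * pi * (2 * d)) {0..2*pi}"
  proof (intro has_integral_add integrable_integral integrable_continuous_real)
    show "continuous_on {0..2*pi} (\<lambda>t. poisson z t * norm (f (cis t)) powr q)"
      by (intro continuous_intros continuous_on_poisson z continuous_on_compose2[OF cu]) auto
    show "((\<lambda>t. poisson z t * (2 * d)) has_integral 2 * pi * (2 * d)) {0..2*pi}"
      by (intro has_integral_mult_left poisson_has_integral_1 z)
  qed
  ultimately have "2 * pi * Re (P z) \<le>
      integral {0..2*pi} (\<lambda>t. poisson z t * norm (f (cis t)) powr q) + 2 * pi * (2 * d)"
  proof (rule has_integral_le)
    fix t
    have "poisson z t * Re (P (cis t)) \<le> poisson z t * (norm (f (cis t)) powr q + 2 * d)"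
      using u(2)[of "cis t"] poisson_nonneg[OF z] by (intro mult_left_mono) auto
    thus "poisson z t * Re (P (cis t)) \<le> poisson z t * norm (f (cis t)) powr q + poisson z t * (2 * d)"
      by (simp add: distrib_left)
  qed
  moreover have "norm (f z) powr q \<le> Re (P z)"
    by (rule maximum_principle_powr[OF f P q u(1) z])
  hence "2 * pi * norm (f z) powr q \<le> 2 * pi * Re (P z)" by simp
  moreover have "2 * pi * (2 * d) = e" by (simp add: d_def)
  ultimately show "2 * pi * norm (f z) powr q \<le>
      integral {0..2*pi} (\<lambda>t. poisson z t * norm (f (cis t)) powr q) + e" by linarith
qed

section \<open>Hardy spaces\<close>

lemma continuous_on_circle_powr:
  assumes "f holomorphic_on ball 0 1" "\<bar>r\<bar> < 1" "0 < p"
  shows "continuous_on A (\<lambda>t. norm (f (of_real r * cis t)) powr p)"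
proof -
  have "continuous_on (ball 0 1) (\<lambda>w. norm (f w) powr p)"
    using assms by (intro continuous_intros continuous_on_powr' holomorphic_on_imp_continuous_on) auto
  thus ?thesis
    by (rule continuous_on_compose2) (use assms in \<open>auto intro!: continuous_intros simp: norm_mult\<close>)
qed

lemma hardyE:
  assumes "f \<in> hardy p"
  obtains M where "f holomorphic_on ball 0 1" "0 \<le> M"
    "\<And>r. 0 \<le> r \<Longrightarrow> r < 1 \<Longrightarrow> integral {0..2*pi} (\<lambda>t. norm (f (of_real r * cis t)) powr p) \<le> M"
proof -
  obtain M where f: "f holomorphic_on ball 0 1" and M: "\<And>r. r \<in> {0..<1} \<Longrightarrow>
      1 / (2*pi) * integral {0..2*pi} (\<lambda>t. norm (f (of_real r * cis t)) powr p) \<le> M"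
    using assms unfolding hardy_def bdd_above_def by blast
  have M': "integral {0..2*pi} (\<lambda>t. norm (f (of_real r * cis t)) powr p) \<le> \<bar>2 * pi * M\<bar>"
    if "0 \<le> r" "r < 1" for r
  proof (rule order_trans[OF _ abs_ge_self])
    show "integral {0..2*pi} (\<lambda>t. norm (f (of_real r * cis t)) powr p) \<le> 2 * pi * M"
      using M[of r] that by (simp add: field_simps)
  qed
  show ?thesis by (rule that[OF f abs_ge_zero M'])
qed

lemma hardyI:
  assumes "f holomorphic_on ball 0 1"
    "\<And>r. 0 \<le> r \<Longrightarrow> r < 1 \<Longrightarrow> integral {0..2*pi} (\<lambda>t. norm (f (of_real r * cis t)) powr p) \<le> M"
  shows "f \<in> hardy p"
  unfolding hardy_def using assms
  by (auto intro!: bdd_aboveI[of _ "M / (2 * pi)"] divide_right_mono)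

lemma norm_dilate_less_1:
  fixes w :: complex
  assumes "0 \<le> r" "r < 1" "norm w \<le> 1"
  shows "norm (of_real r * w) < 1"
  using mult_mono[of r r "norm w" 1] assms by (auto simp: norm_mult)

lemma dilate_in_disk_algebra:
  fixes f :: "complex \<Rightarrow> complex"
  assumes f: "f holomorphic_on ball 0 1" and r: "0 \<le> r" "r < 1"
  shows "continuous_on (cball 0 1) (\<lambda>w. f (of_real r * w))"
    and "(\<lambda>w. f (of_real r * w)) holomorphic_on ball 0 1"
proof -
  note sub = norm_dilate_less_1[OF r]
  show "continuous_on (cball 0 1) (\<lambda>w. f (of_real r * w))"
    by (rule continuous_on_compose2[OF holomorphic_on_imp_continuous_on[OF f]])
      (use sub in \<open>auto intro!: continuous_intros\<close>)
  have "f \<circ> (\<lambda>w. of_real r * w) holomorphic_on ball 0 1"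
    by (rule holomorphic_on_compose_gen[OF _ f]) (use sub in \<open>auto intro!: holomorphic_intros\<close>)
  thus "(\<lambda>w. f (of_real r * w)) holomorphic_on ball 0 1"
    by (simp add: o_def)
qed

lemma disk_self_mapD:
  assumes "disk_self_map \<phi>"
  shows "\<phi> holomorphic_on ball 0 1" and "norm w < 1 \<Longrightarrow> norm (\<phi> w) < 1"
  using assms unfolding disk_self_map_def by (auto simp: image_subset_iff)

lemma hardy_infE:
  assumes "f \<in> hardy_inf"
  obtains B where "f holomorphic_on ball 0 1" "\<And>w. norm w < 1 \<Longrightarrow> norm (f w) \<le> B"
proof -
  obtain B where "\<forall>w\<in>ball 0 1. norm (f w) \<le> B"
    using assms unfolding hardy_inf_def bounded_iff by blast
  with assms that[of B] show ?thesis unfolding hardy_inf_def by simp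
qed

lemma norm_powr_le_poisson_integral_dilate:
  assumes f: "f holomorphic_on ball 0 1" and r: "0 \<le> r" "r < 1" and q: "0 < q" and z: "norm z < 1"
  shows "2 * pi * norm (f (of_real r * z)) powr q
          \<le> integral {0..2*pi} (\<lambda>t. poisson z t * norm (f (of_real r * cis t)) powr q)"
  using norm_powr_le_poisson_integral[OF dilate_in_disk_algebra[OF f r] q z] .

section \<open>Littlewood's subordination principle\<close>

text \<open>
  The Poisson kernel is the real part of \<open>(cis s + z) / (cis s - z)\<close>, hence stays harmonic
  after substituting \<open>\<phi>\<close>; the mean value property is the Poisson formula at the centre.
\<close>
lemma poisson_mean_value:
  assumes \<phi>: "disk_self_map \<phi>" and r: "0 \<le> r" "r < 1"
  shows "((\<lambda>t. poisson (\<phi> (of_real r * cis t)) s) has_integral 2 * pi * poisson (\<phi> 0) s) {0..2*pi}"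
proof -
  note h = disk_self_mapD(1)[OF \<phi>] and m = disk_self_mapD(2)[OF \<phi>]
  note sub = norm_dilate_less_1[OF r]
  define F where "F = (\<lambda>w. (cis s + \<phi> (of_real r * w)) / (cis s - \<phi> (of_real r * w)))"
  have ne: "cis s - \<phi> (of_real r * w) \<noteq> 0" if "norm w \<le> 1" for w
    using cis_neq_in_disk[OF m[OF sub[OF that]]] by simp
  have "continuous_on (cball 0 1) F" "F holomorphic_on ball 0 1"
    unfolding F_def using ne by (auto intro!: continuous_intros holomorphic_intros dilate_in_disk_algebra[OF h r])
  from poisson_formula[OF this, of 0] have "((\<lambda>t. F (cis t)) has_integral 2 * of_real pi * F 0) {0..2*pi}"
    by (simp add: poisson_def)
  from has_integral_Re[OF this]
  have "((\<lambda>t. Re (F (cis t))) has_integral 2 * pi * Re (F 0)) {0..2*pi}" by (simp del: of_real_mult)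
  moreover have "Re (F w) = poisson (\<phi> (of_real r * w)) s" if "norm w \<le> 1" for w
    using poisson_eq_Re[OF m[OF sub[OF that]]] by (simp add: F_def)
  ultimately show ?thesis by simp
qed

text \<open>
  The Poisson kernel at \<open>\<phi> 0\<close> is bounded by a constant \<open>b\<close>, and averaging over \<open>t\<close> replaces the
  kernel at \<open>\<phi> (r e\<^sup>i\<^sup>t)\<close> by the kernel at \<open>\<phi> 0\<close>. So the means of \<open>|g \<circ> \<phi>|\<^sup>p\<close> are at most \<open>b\<close>
  times those of \<open>|g|\<^sup>p\<close>. The dilation parameter \<open>\<rho>\<close> keeps \<open>g\<close> inside the disk and tends to
  \<open>1\<close> at the end, for fixed \<open>r\<close>.
\<close>
theorem littlewood_subordination:
  assumes \<phi>: "disk_self_map \<phi>" and g: "g \<in> hardy p" and p: "0 < p"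
  shows "g \<circ> \<phi> \<in> hardy p"
proof -
  note h = disk_self_mapD(1)[OF \<phi>] and m = disk_self_mapD(2)[OF \<phi>]
  obtain M where g: "g holomorphic_on ball 0 1" and M0: "0 \<le> M"
    and M: "\<And>r. 0 \<le> r \<Longrightarrow> r < 1 \<Longrightarrow> integral {0..2*pi} (\<lambda>t. norm (g (of_real r * cis t)) powr p) \<le> M"
    using g by (rule hardyE) blast
  define b where "b = 2 / (1 - norm (\<phi> 0))"
  have b0: "b \<ge> 0" using m[of 0] by (simp add: b_def)
  have gc: "continuous_on (ball 0 1) (\<lambda>w. norm (g w) powr p)"
    using g p by (intro continuous_intros continuous_on_powr' holomorphic_on_imp_continuous_on) auto
  show ?thesis
  proof (rule hardyI)
    show "g \<circ> \<phi> holomorphic_on ball 0 1"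
      by (rule holomorphic_on_compose_gen[OF h g]) (use m in auto)
    fix r :: real assume r: "0 \<le> r" "r < 1"
    have rt: "norm (\<phi> (of_real r * cis t)) < 1" for t
      using r by (intro m) (simp add: norm_mult)
    have cr: "continuous_on A (\<lambda>t. \<phi> (of_real r * cis t))" for A
      by (rule continuous_on_compose2[OF holomorphic_on_imp_continuous_on[OF h]])
        (use r in \<open>auto intro!: continuous_intros simp: norm_mult\<close>)
    define J where "J = (\<lambda>\<rho>. integral {0..2*pi} (\<lambda>t. norm (g (of_real \<rho> * \<phi> (of_real r * cis t))) powr p))"
    have J: "J \<rho> \<le> b * M" if \<rho>: "0 \<le> \<rho>" "\<rho> < 1" for \<rho>
    proof -
      define u where "u = (\<lambda>s. norm (g (of_real \<rho> * cis s)) powr p)"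
      have u: "continuous_on A u" for A
        unfolding u_def using \<rho> by (intro continuous_on_circle_powr g p) auto
      define k where "k = (\<lambda>t s. poisson (\<phi> (of_real r * cis t)) s * u s)"
      have kc: "continuous_on A (\<lambda>(t,s). k t s)" for A
        unfolding k_def poisson_def case_prod_beta
        by (intro continuous_intros continuous_on_compose2[OF cr[of UNIV]] continuous_on_compose2[OF u[of UNIV]])
          (auto simp: cis_neq_in_disk[OF rt])
      have le: "2 * pi * norm (g (of_real \<rho> * \<phi> (of_real r * cis t))) powr p \<le> integral {0..2*pi} (k t)" for t
        using norm_powr_le_poisson_integral_dilate[OF g \<rho> p rt] by (simp add: k_def u_def)
      have sub: "norm (of_real \<rho> * w) < 1" if "norm w < 1" for w :: complex
        using mult_mono[of \<rho> 1 "norm w" "norm w"] \<rho> that by (auto simp: norm_mult)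
      have c1: "continuous_on {0..2*pi} (\<lambda>t. norm (g (of_real \<rho> * \<phi> (of_real r * cis t))) powr p)"
        by (rule continuous_on_compose2[OF gc]) (auto intro!: continuous_intros cr sub rt)
      have c2: "continuous_on {0..2*pi} (\<lambda>t. integral {0..2*pi} (k t))"
        using integral_continuous_on_param[OF kc, of "{0..2*pi}" 0 "2*pi"] by simp
      have "2 * pi * J \<rho> = integral {0..2*pi} (\<lambda>t. 2 * pi * norm (g (of_real \<rho> * \<phi> (of_real r * cis t))) powr p)"
        unfolding J_def by (rule integral_mult_right[symmetric])
      also have "\<dots> \<le> integral {0..2*pi} (\<lambda>t. integral {0..2*pi} (k t))"
        by (intro integral_le integrable_continuous_real c1 c2 continuous_on_mult_left le)
      also have "\<dots> = integral {0..2*pi} (\<lambda>s. integral {0..2*pi} (\<lambda>t. k t s))"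
        using integral_swap_continuous[where f = k and a = 0 and b = "2*pi" and c = 0 and d = "2*pi", OF kc]
        by simp
      also have "\<dots> = integral {0..2*pi} (\<lambda>s. 2 * pi * poisson (\<phi> 0) s * u s)"
        unfolding k_def using integral_unique[OF poisson_mean_value[OF \<phi> r]] by simp
      also have "\<dots> \<le> integral {0..2*pi} (\<lambda>s. 2 * pi * b * u s)"
      proof (intro integral_le integrable_continuous_real continuous_intros u continuous_on_poisson)
        show "norm (\<phi> 0) < 1" using m by simp
        fix s show "2 * pi * poisson (\<phi> 0) s * u s \<le> 2 * pi * b * u s"
          using poisson_le[of "\<phi> 0" s] m[of 0]
          by (intro mult_right_mono mult_left_mono) (auto simp: b_def u_def)
      qed
      also have "\<dots> = 2 * pi * (b * integral {0..2*pi} u)"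
        by (simp add: mult.assoc)
      also have "\<dots> \<le> 2 * pi * (b * M)"
        using M[OF \<rho>] b0 by (intro mult_left_mono) (auto simp: u_def)
      finally show ?thesis by simp
    qed
    have "continuous_on {0..1} J"
    proof -
      have "continuous_on ({0..1} \<times> cbox 0 (2*pi))
         (\<lambda>(\<rho>,t). norm (g (of_real \<rho> * \<phi> (of_real r * cis t))) powr p)"
        unfolding case_prod_beta
      proof (rule continuous_on_compose2[OF gc])
        show "(\<lambda>x. of_real (fst x) * \<phi> (of_real r * cis (snd x))) ` ({0..1} \<times> cbox 0 (2*pi)) \<subseteq> ball 0 1"
          using rt mult_mono[of _ 1 "norm (\<phi> (of_real r * cis _))" "norm (\<phi> (of_real r * cis _))"]
          by (fastforce simp: norm_mult intro: le_less_trans)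
      qed (intro continuous_intros continuous_on_compose2[OF cr[of UNIV]], auto)
      from integral_continuous_on_param[OF this] show ?thesis by (simp add: J_def)
    qed
    hence "J 1 \<le> b * M"
      using continuous_le_on_closure[of "{0..<1}" J 1 "b * M"] J by simp
    thus "integral {0..2*pi} (\<lambda>t. norm ((g \<circ> \<phi>) (of_real r * cis t)) powr p) \<le> b * M"
      by (simp add: J_def)
  qed
qed

section \<open>Quotients by inner functions\<close>

text \<open>
  The integrand tends to \<open>0\<close> almost everywhere by the definition of an inner function, and it is
  uniformly bounded, so dominated convergence applies.
\<close>
lemma inner_function_defect_tendsto_0:
  assumes \<theta>: "inner_function \<theta>" and q: "0 < q"
    and r: "\<And>n. 0 \<le> r n" "\<And>n. r n < 1" "r \<longlonglongrightarrow> (1::real)"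
  shows "(\<lambda>n. integral {0..2*pi} (\<lambda>t. (1 - norm (\<theta> (of_real (r n) * cis t)) powr q)\<^sup>2)) \<longlonglongrightarrow> 0"
proof -
  let ?L = "lebesgue_on {0..2*pi}"
  let ?e = "\<lambda>n t. (1 - norm (\<theta> (of_real (r n) * cis t)) powr q)\<^sup>2"
  have "\<theta> \<in> hardy_inf" using \<theta> by (simp add: inner_function_def)
  then obtain B where h: "\<theta> holomorphic_on ball 0 1" and B: "\<And>w. norm w < 1 \<Longrightarrow> norm (\<theta> w) \<le> B"
    by (rule hardy_infE) blast
  have c: "continuous_on {0..2*pi} (?e n)" for n
    using r(1,2)[of n] by (intro continuous_intros continuous_on_circle_powr h q) auto
  note int = continuous_imp_integrable_real[OF c]
  have r_left: "filterlim r (at_left 1) sequentially"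
    using r(3) by (simp add: filterlim_at r(2) less_imp_neq[OF r(2)])
  have "(\<lambda>n. integral\<^sup>L ?L (?e n)) \<longlonglongrightarrow> integral\<^sup>L ?L (\<lambda>_. 0)"
  proof (rule integral_dominated_convergence[where w = "\<lambda>_. (1 + B powr q)\<^sup>2"])
    show "integrable ?L (\<lambda>_. (1 + B powr q)\<^sup>2)"
      by (intro continuous_imp_integrable_real continuous_intros)
    show "?e n \<in> borel_measurable ?L" for n
      using int by (rule borel_measurable_integrable)
    have "AE t in ?L. \<exists>L. ((\<lambda>r. \<theta> (of_real r * cis t)) \<longlongrightarrow> L) (at_left (1::real)) \<and> norm L = 1"
      using \<theta> unfolding inner_function_def by auto
    thus "AE t in ?L. (\<lambda>n. ?e n t) \<longlonglongrightarrow> 0"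
    proof (rule AE_mp, intro AE_I2 impI)
      fix t
      assume "\<exists>L. ((\<lambda>r. \<theta> (of_real r * cis t)) \<longlongrightarrow> L) (at_left (1::real)) \<and> norm L = 1"
      then obtain L where L: "((\<lambda>r. \<theta> (of_real r * cis t)) \<longlongrightarrow> L) (at_left (1::real))" "norm L = 1"
        by blast
      have "(\<lambda>n. \<theta> (of_real (r n) * cis t)) \<longlonglongrightarrow> L"
        by (rule filterlim_compose[OF L(1) r_left])
      hence "(\<lambda>n. ?e n t) \<longlonglongrightarrow> (1 - norm L powr q)\<^sup>2"
        using L(2) by (intro tendsto_intros) auto
      thus "(\<lambda>n. ?e n t) \<longlonglongrightarrow> 0" using L(2) by simp
    qed
    show "AE t in ?L. norm (?e n t) \<le> (1 + B powr q)\<^sup>2" for n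
    proof (intro AE_I2)
      fix t
      have "norm (\<theta> (of_real (r n) * cis t)) powr q \<le> B powr q"
        using B[of "of_real (r n) * cis t"] r(1,2)[of n] q by (intro powr_mono2) (auto simp: norm_mult)
      hence "\<bar>1 - norm (\<theta> (of_real (r n) * cis t)) powr q\<bar> \<le> 1 + B powr q"
        using powr_ge_zero[of "norm (\<theta> (of_real (r n) * cis t))" q] by linarith
      from power_mono[OF this, of 2] show "norm (?e n t) \<le> (1 + B powr q)\<^sup>2" by simp
    qed
  qed simp
  thus ?thesis
    using lebesgue_integral_eq_integral[OF int] by simp
qed

text \<open>
  Young's inequality for \<open>u * (1 - s)\<close>. It separates the part \<open>d * u\<^sup>2\<close>, which is small in mean
  for small \<open>d\<close>, from the part depending on the defect \<open>1 - s\<close>, which vanishes in the limit for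
  each fixed \<open>d\<close>.
\<close>
lemma mult_defect_le:
  fixes u s d :: real
  assumes "0 < d"
  shows "u \<le> u * s + d * u\<^sup>2 + (1 - s)\<^sup>2 / (4 * d)"
proof -
  have "0 \<le> (2 * d * u - (1 - s))\<^sup>2 / (4 * d)" using assms by simp
  also have "\<dots> = d * u\<^sup>2 + (1 - s)\<^sup>2 / (4 * d) - u * (1 - s)"
    using assms by (simp add: field_simps power2_eq_square)
  finally show ?thesis by (simp add: algebra_simps)
qed

text \<open>
  A form of Smirnov's maximum principle. With \<open>u = |f|\<^sup>q\<close> and \<open>s = |\<theta>|\<^sup>q\<close> on the circle of
  radius \<open>r n\<close>, the product \<open>u * s\<close> is at most \<open>C\<^sup>q\<close>, and Young's inequality bounds the Poisson
  integral of \<open>u\<close> by that of the constant \<open>C\<^sup>q\<close> plus two errors. The choice \<open>q = p / 2\<close> makes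
  \<open>u\<^sup>2 = |f|\<^sup>p\<close>, whose means are bounded.
\<close>
theorem hardy_quotient_by_inner_bounded:
  assumes \<theta>: "inner_function \<theta>" and f: "f \<in> hardy p" and p: "0 < p"
    and C: "\<And>w. norm w < 1 \<Longrightarrow> norm (\<theta> w * f w) \<le> C" and z: "norm z < 1"
  shows "norm (f z) \<le> C"
proof -
  obtain M where f: "f holomorphic_on ball 0 1" and M0: "0 \<le> M"
    and M: "\<And>r. 0 \<le> r \<Longrightarrow> r < 1 \<Longrightarrow> integral {0..2*pi} (\<lambda>t. norm (f (of_real r * cis t)) powr p) \<le> M"
    using f by (rule hardyE) blast
  have h: "\<theta> holomorphic_on ball 0 1"
    using \<theta> unfolding inner_function_def hardy_inf_def by auto
  have C0: "0 \<le> C" using order_trans[OF norm_ge_zero C[of 0]] by simp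
  define q where "q = p / 2"
  have q: "0 < q" using p by (simp add: q_def)
  define b where "b = 2 / (1 - norm z)"
  have b: "0 < b" using z by (simp add: b_def)
  define r where "r = (\<lambda>n. 1 + - inverse (real (Suc n)))"
  have r: "0 \<le> r n" "r n < 1" for n
    by (auto simp: r_def divide_simps)
  have r_lim: "r \<longlonglongrightarrow> 1"
    unfolding r_def by (rule LIMSEQ_inverse_real_of_nat_add_minus)
  define E where "E = (\<lambda>n. integral {0..2*pi} (\<lambda>t. (1 - norm (\<theta> (of_real (r n) * cis t)) powr q)\<^sup>2))"
  have E: "E \<longlonglongrightarrow> 0"
    unfolding E_def by (rule inner_function_defect_tendsto_0[OF \<theta> q r r_lim])
  have bound: "2 * pi * norm (f (of_real (r n) * z)) powr q
       \<le> 2 * pi * C powr q + b * (d * M) + b / (4 * d) * E n" if d: "0 < d" for n d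
  proof -
    define u where "u = (\<lambda>t. norm (f (of_real (r n) * cis t)) powr q)"
    define s where "s = (\<lambda>t. norm (\<theta> (of_real (r n) * cis t)) powr q)"
    have us: "continuous_on A u" "continuous_on A s" for A
      unfolding u_def s_def using r[of n] by (auto intro!: continuous_on_circle_powr f h q)
    have u2: "(u t)\<^sup>2 = norm (f (of_real (r n) * cis t)) powr p" for t
      unfolding u_def q_def power2_eq_square by (simp flip: powr_add)
    have usC: "u t * s t \<le> C powr q" for t
    proof -
      have "u t * s t = norm (\<theta> (of_real (r n) * cis t) * f (of_real (r n) * cis t)) powr q"
        by (simp add: u_def s_def powr_mult norm_mult)
      also have "\<dots> \<le> C powr q"
        using r[of n] q by (intro powr_mono2 C) (auto simp: norm_mult)
      finally show ?thesis .
    qed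
    have le: "poisson z t * u t \<le> poisson z t * C powr q + (b * d * (u t)\<^sup>2 + b / (4 * d) * (1 - s t)\<^sup>2)" for t
    proof -
      define X where "X = d * (u t)\<^sup>2 + (1 - s t)\<^sup>2 / (4 * d)"
      have X: "0 \<le> X" using d by (simp add: X_def)
      have "poisson z t * u t \<le> poisson z t * (C powr q + X)"
        using mult_defect_le[OF d, of "u t" "s t"] usC[of t] poisson_nonneg[OF z]
        by (intro mult_left_mono) (auto simp: X_def)
      also have "\<dots> = poisson z t * C powr q + poisson z t * X"
        by (rule distrib_left)
      also have "\<dots> \<le> poisson z t * C powr q + b * X"
        using mult_right_mono[OF poisson_le[OF z, of t] X] by (simp add: b_def)
      finally show ?thesis by (simp add: X_def algebra_simps)
    qed
    have "2 * pi * norm (f (of_real (r n) * z)) powr q \<le> integral {0..2*pi} (\<lambda>t. poisson z t * u t)"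
      unfolding u_def by (rule norm_powr_le_poisson_integral_dilate[OF f r q z])
    also have "\<dots> \<le> 2 * pi * C powr q + (b * d * integral {0..2*pi} (\<lambda>t. (u t)\<^sup>2) + b / (4 * d) * E n)"
    proof (rule has_integral_le)
      show "((\<lambda>t. poisson z t * u t) has_integral integral {0..2*pi} (\<lambda>t. poisson z t * u t)) {0..2*pi}"
        by (intro integrable_integral integrable_continuous_real continuous_intros us continuous_on_poisson z)
      have "((\<lambda>t. (1 - s t)\<^sup>2) has_integral E n) {0..2*pi}"
        unfolding E_def s_def using r[of n]
        by (intro integrable_integral integrable_continuous_real continuous_intros
             continuous_on_circle_powr h q) auto
      thus "((\<lambda>t. poisson z t * C powr q + (b * d * (u t)\<^sup>2 + b / (4 * d) * (1 - s t)\<^sup>2)) has_integral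
         2 * pi * C powr q + (b * d * integral {0..2*pi} (\<lambda>t. (u t)\<^sup>2) + b / (4 * d) * E n)) {0..2*pi}"
        by (intro has_integral_add has_integral_mult_left has_integral_mult_right poisson_has_integral_1 z
             integrable_integral integrable_continuous_real continuous_intros us)
    qed (rule le)
    also have "\<dots> \<le> 2 * pi * C powr q + (b * d * M + b / (4 * d) * E n)"
      using M[OF r] b d unfolding u2 by (intro add_mono mult_left_mono) auto
    finally show ?thesis by (simp add: mult.assoc)
  qed
  have "isCont f z"
    using holomorphic_on_imp_continuous_on[OF f] z by (simp add: continuous_on_eq_continuous_at)
  moreover have "(\<lambda>n. of_real (r n) * z) \<longlonglongrightarrow> of_real 1 * z"
    by (intro tendsto_intros r_lim)
  ultimately have "(\<lambda>n. f (of_real (r n) * z)) \<longlonglongrightarrow> f z"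
    by (intro isCont_tendsto_compose[of z f]) auto
  hence lim: "(\<lambda>n. 2 * pi * norm (f (of_real (r n) * z)) powr q) \<longlonglongrightarrow> 2 * pi * norm (f z) powr q"
    using q by (intro tendsto_intros tendsto_powr') auto
  have lim_le: "2 * pi * norm (f z) powr q \<le> 2 * pi * C powr q + b * (d * M)" if d: "0 < d" for d
  proof -
    have "(\<lambda>n. 2 * pi * C powr q + b * (d * M) + b / (4 * d) * E n)
        \<longlonglongrightarrow> 2 * pi * C powr q + b * (d * M) + b / (4 * d) * 0"
      by (intro tendsto_intros E)
    from LIMSEQ_le[OF lim this] bound[OF d] show ?thesis by auto
  qed
  have "2 * pi * norm (f z) powr q \<le> 2 * pi * C powr q"
  proof (rule field_le_epsilon)
    fix e :: real assume e: "0 < e"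
    \<comment> \<open>\<open>M + 1\<close> rather than \<open>M\<close>, because \<open>M\<close> may vanish.\<close>
    define d where "d = e / (b * (M + 1))"
    have "0 < d" using e b M0 by (simp add: d_def)
    moreover have "b * (d * M) \<le> e"
    proof -
      have "b * (d * M) = e * (M / (M + 1))" using b by (simp add: d_def)
      also have "\<dots> \<le> e * 1" using M0 e by (intro mult_left_mono) auto
      finally show ?thesis by simp
    qed
    ultimately show "2 * pi * norm (f z) powr q \<le> 2 * pi * C powr q + e"
      using lim_le[of d] by linarith
  qed
  hence "norm (f z) powr q \<le> C powr q" by simp
  thus ?thesis
    using powr_less_mono2[OF q C0, of "norm (f z)"] by (meson not_le)
qed

lemma hardy_one: "(\<lambda>_. 1) \<in> hardy p"
  by (rule hardyI[where M = "2 * pi"]) auto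

lemma hardy_mult_bounded:
  assumes k: "k \<in> hardy_inf" and g: "g \<in> hardy p" and p: "0 < p"
  shows "(\<lambda>z. k z * g z) \<in> hardy p"
proof -
  obtain M where g: "g holomorphic_on ball 0 1"
    and M: "\<And>r. 0 \<le> r \<Longrightarrow> r < 1 \<Longrightarrow> integral {0..2*pi} (\<lambda>t. norm (g (of_real r * cis t)) powr p) \<le> M"
    using g by (rule hardyE) blast
  obtain B where k: "k holomorphic_on ball 0 1" and B: "\<And>w. norm w < 1 \<Longrightarrow> norm (k w) \<le> B"
    using k by (rule hardy_infE) blast
  have kg: "(\<lambda>z. k z * g z) holomorphic_on ball 0 1"
    using k g by (intro holomorphic_intros)
  show ?thesis
  proof (rule hardyI[OF kg])
    fix r :: real assume r: "0 \<le> r" "r < 1"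
    have "integral {0..2*pi} (\<lambda>t. norm (k (of_real r * cis t) * g (of_real r * cis t)) powr p)
       \<le> integral {0..2*pi} (\<lambda>t. B powr p * norm (g (of_real r * cis t)) powr p)"
    proof (rule integral_le)
      show "(\<lambda>t. norm (k (of_real r * cis t) * g (of_real r * cis t)) powr p) integrable_on {0..2*pi}"
        using r by (intro integrable_continuous_real continuous_on_circle_powr[OF kg] p) auto
      show "(\<lambda>t. B powr p * norm (g (of_real r * cis t)) powr p) integrable_on {0..2*pi}"
        using r by (intro integrable_continuous_real continuous_on_mult_left continuous_on_circle_powr[OF g] p) auto
      fix t
      show "norm (k (of_real r * cis t) * g (of_real r * cis t)) powr p \<le> B powr p * norm (g (of_real r * cis t)) powr p"
        using B[of "of_real r * cis t"] r p
        by (auto simp: norm_mult powr_mult intro!: mult_right_mono powr_mono2)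
    qed
    also have "\<dots> \<le> B powr p * M"
      using M[OF r] by (simp add: mult_left_mono)
    finally show "integral {0..2*pi} (\<lambda>t. norm (k (of_real r * cis t) * g (of_real r * cis t)) powr p) \<le> B powr p * M" .
  qed
qed

lemma mult_spaceI:
  assumes "f \<in> X" "\<And>z. z \<in> ball 0 1 \<Longrightarrow> g z = \<theta> z * f z"
  shows "g \<in> mult_space \<theta> X"
  using assms unfolding mult_space_def by blast

theorem theorem3p1:
  fixes \<theta>\<^sub>1 \<theta>\<^sub>2 \<phi> :: "complex \<Rightarrow> complex"
  assumes "inner_function \<theta>\<^sub>1" and "inner_function \<theta>\<^sub>2" and "disk_self_map \<phi>"
  shows "(\<exists>p::real. p > 0 \<and>
            composition_op \<phi> ` mult_space \<theta>\<^sub>1 (hardy p) \<subseteq> mult_space \<theta>\<^sub>2 (hardy p))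
         \<longleftrightarrow> (\<exists>f\<in>hardy_inf. \<forall>z\<in>ball 0 1. (\<theta>\<^sub>1 \<circ> \<phi>) z = \<theta>\<^sub>2 z * f z)"
proof
  have m: "\<phi> w \<in> ball 0 1" if "w \<in> ball 0 1" for w
    using disk_self_mapD(2)[OF assms(3)] that by simp
  {
    assume "\<exists>p::real. p > 0 \<and>
            composition_op \<phi> ` mult_space \<theta>\<^sub>1 (hardy p) \<subseteq> mult_space \<theta>\<^sub>2 (hardy p)"
    then obtain p where p: "0 < p"
      and sub: "composition_op \<phi> ` mult_space \<theta>\<^sub>1 (hardy p) \<subseteq> mult_space \<theta>\<^sub>2 (hardy p)" by blast
    have "\<theta>\<^sub>1 \<in> mult_space \<theta>\<^sub>1 (hardy p)"
      by (rule mult_spaceI[OF hardy_one]) simp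
    from subsetD[OF sub imageI[OF this]] have "\<theta>\<^sub>1 \<circ> \<phi> \<in> mult_space \<theta>\<^sub>2 (hardy p)"
      unfolding composition_op_def .
    then obtain f where f: "f \<in> hardy p" and eq: "\<forall>z\<in>ball 0 1. (\<theta>\<^sub>1 \<circ> \<phi>) z = \<theta>\<^sub>2 z * f z"
      unfolding mult_space_def by blast
    have "\<theta>\<^sub>1 \<in> hardy_inf" using assms(1) by (simp add: inner_function_def)
    then obtain C where C: "\<And>w. norm w < 1 \<Longrightarrow> norm (\<theta>\<^sub>1 w) \<le> C"
      by (rule hardy_infE) blast
    have "norm (f z) \<le> C" if "norm z < 1" for z
    proof (rule hardy_quotient_by_inner_bounded[OF assms(2) f p _ that])
      show "norm (\<theta>\<^sub>2 w * f w) \<le> C" if "norm w < 1" for w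
      proof -
        have "\<theta>\<^sub>1 (\<phi> w) = \<theta>\<^sub>2 w * f w" using bspec[OF eq, of w] that by simp
        moreover have "norm (\<phi> w) < 1" using m[of w] that by simp
        ultimately show ?thesis using C[of "\<phi> w"] by simp
      qed
    qed
    hence "bounded (f ` ball 0 1)"
      by (intro boundedI[of _ C]) auto
    hence "f \<in> hardy_inf"
      using f by (simp add: hardy_inf_def hardy_def)
    with eq show "\<exists>f\<in>hardy_inf. \<forall>z\<in>ball 0 1. (\<theta>\<^sub>1 \<circ> \<phi>) z = \<theta>\<^sub>2 z * f z"
      by (intro bexI[of _ f])
  next
    assume "\<exists>f\<in>hardy_inf. \<forall>z\<in>ball 0 1. (\<theta>\<^sub>1 \<circ> \<phi>) z = \<theta>\<^sub>2 z * f z"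
    then obtain f where f: "f \<in> hardy_inf" and eq: "\<forall>z\<in>ball 0 1. (\<theta>\<^sub>1 \<circ> \<phi>) z = \<theta>\<^sub>2 z * f z"
      by (rule bexE)
    have "composition_op \<phi> k \<in> mult_space \<theta>\<^sub>2 (hardy 1)" if k: "k \<in> mult_space \<theta>\<^sub>1 (hardy 1)" for k
    proof -
      obtain g where g: "g \<in> hardy 1" and kg: "\<And>z. z \<in> ball 0 1 \<Longrightarrow> k z = \<theta>\<^sub>1 z * g z"
        using k unfolding mult_space_def by blast
      have "g \<circ> \<phi> \<in> hardy 1"
        by (rule littlewood_subordination[OF assms(3) g zero_less_one])
      from hardy_mult_bounded[OF f this zero_less_one]
      have "(\<lambda>z. f z * (g \<circ> \<phi>) z) \<in> hardy 1" .
      moreover have "composition_op \<phi> k z = \<theta>\<^sub>2 z * (f z * (g \<circ> \<phi>) z)" if "z \<in> ball 0 1" for z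
        using kg[OF m[OF that]] bspec[OF eq that] by (simp add: composition_op_def)
      ultimately show ?thesis by (rule mult_spaceI)
    qed
    hence "composition_op \<phi> ` mult_space \<theta>\<^sub>1 (hardy 1) \<subseteq> mult_space \<theta>\<^sub>2 (hardy 1)"
      by (rule image_subsetI)
    thus "\<exists>p::real. p > 0 \<and>
            composition_op \<phi> ` mult_space \<theta>\<^sub>1 (hardy p) \<subseteq> mult_space \<theta>\<^sub>2 (hardy p)"
      by (intro exI[of _ 1] conjI zero_less_one)
  }
qed

end
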